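(* Let $n\ge1$ and let $s\in\mathbb{R}^{\mathcal{P}_n}$. The following are equivalent: (1) $s\in\operatorname{im}T$, i.e. there is $f\colon 2^{[n]}\to\mathbb{R}$ with $s_{I,J}=f(I\cap J)+f(I\cup J)-f(I)-f(J)$ for every close pair $\{I,J\}$; (2) there exist reals $m_1,\dots,m_n$ such that $P_\sigma(s)=m_{\sigma_1}$ for all $\sigma\in S_n$; (3) for all distinct $i,j,k\in[n]$ and all $I\subseteq[n]\setminus\{i,j,k\}$, $$s_{I\cup\{i\},I\cup\{j\}}+s_{I\cup\{i,j\},I\cup\{j,k\}}=s_{I\cup\{i\},I\cup\{k\}}+s_{I\cup\{i,k\},I\cup\{j,k\}}.$$
   Context: An unordered pair $\{I,J\}$ of subsets of $[n]$ is close if $|I|=|J|=|I\cap J|+1=|I\cup J|-1$; $\mathcal{P}_n$ is the set of all close pairs, and vectors $s\in\mathbb{R}^{\mathcal{P}_n}$ are indexed by unordered close pairs, written $s_{I,J}=s_{J,I}$. $T\colon\mathbb{R}^{2^{[n]}}\to\mathbb{R}^{\mathcal{P}_n}$ is the linear map sending $f$ to $s$ with $s_{I,J}=f(I\cap J)+f(I\cup J)-f(I)-f(J)$. For a permutation $\sigma=(\sigma_1,\dots,\sigma_n)\in S_n$ and $1\le r\le n-1$ let $I_r(\sigma)=\{\sigma_1,\dots,\sigma_r\}$ and $J_r(\sigma)=\{\sigma_2,\dots,\sigma_{r+1}\}$ (so $\{I_r(\sigma),J_r(\sigma)\}$ is a close pair). The path sum of $s$ along $\sigma$ is $P_\sigma(s)=\sum_{r=1}^{n-1}s_{I_r(\sigma),J_r(\sigma)}$.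 *)

theory Defs
  imports Complex_Main "HOL-Library.FuncSet" "HOL-Combinatorics.Permutations"
begin

text \<open>
  The ground set \<open>[n]\<close> is \<^term>\<open>{1..n::nat}\<close>. Unordered pairs are two-element sets of sets, and
  \<open>\<real>\<^sup>X\<close> is rendered as \<^term>\<open>X \<rightarrow>\<^sub>E (UNIV :: real set)\<close>, so that a vector is determined by its
  entries at the elements of \<open>X\<close>.
\<close>

text \<open>The sizes are compared as integers because of the subtraction in the last equation.\<close>

definition close :: "nat set \<Rightarrow> nat set \<Rightarrow> bool" where
  "close I J \<longleftrightarrow>
     int (card I) = int (card J) \<and>
     int (card J) = int (card (I \<inter> J)) + 1 \<and>
     int (card (I \<inter> J)) + 1 = int (card (I \<union> J)) - 1"

definition close_pairs :: "nat \<Rightarrow> nat set set set" where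
  "close_pairs n = {{I, J} | I J. I \<subseteq> {1..n} \<and> J \<subseteq> {1..n} \<and> close I J}"

text \<open>
  For an unordered pair \<open>p = {I, J}\<close> with \<open>I \<noteq> J\<close>, the terms \<open>\<Inter>p\<close>, \<open>\<Union>p\<close> and \<open>\<Sum>A\<in>p. f A\<close> are
  \<open>I \<inter> J\<close>, \<open>I \<union> J\<close> and \<open>f I + f J\<close>; see \<open>T_apply\<close> below.
\<close>

definition T :: "nat \<Rightarrow> (nat set \<Rightarrow> real) \<Rightarrow> (nat set set \<Rightarrow> real)" where
  "T n f = (\<lambda>p \<in> close_pairs n. f (\<Inter>p) + f (\<Union>p) - (\<Sum>A\<in>p. f A))"

lemma close_imp_neq: "close I J \<Longrightarrow> I \<noteq> J"
proof
  assume "close I J" "I = J"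
  then have "int (card J) = int (card J) + 1" unfolding close_def by simp
  then show False by simp
qed

lemma T_apply:
  assumes "I \<subseteq> {1..n}" "J \<subseteq> {1..n}" "close I J"
  shows "T n f {I, J} = f (I \<inter> J) + f (I \<union> J) - f I - f J"
proof -
  have "{I, J} \<in> close_pairs n"
    using assms unfolding close_pairs_def by blast
  then show ?thesis
    using close_imp_neq[OF assms(3)] by (simp add: T_def)
qed

definition im_T :: "nat \<Rightarrow> (nat set set \<Rightarrow> real) set" where
  "im_T n = T n ` (Pow {1..n} \<rightarrow>\<^sub>E UNIV)"

lemma in_im_T_iff:
  assumes s: "s \<in> close_pairs n \<rightarrow>\<^sub>E UNIV"
  shows "s \<in> im_T n \<longleftrightarrow>
    (\<exists>f. \<forall>I J. I \<subseteq> {1..n} \<longrightarrow> J \<subseteq> {1..n} \<longrightarrow> close I J \<longrightarrow>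
       s {I, J} = f (I \<inter> J) + f (I \<union> J) - f I - f J)"
    (is "_ \<longleftrightarrow> ?R")
proof
  assume "s \<in> im_T n"
  then obtain f where "s = T n f" by (auto simp: im_T_def)
  then show ?R by (blast intro: T_apply)
next
  assume ?R
  then obtain f where f: "\<And>I J. I \<subseteq> {1..n} \<Longrightarrow> J \<subseteq> {1..n} \<Longrightarrow> close I J \<Longrightarrow>
      s {I, J} = f (I \<inter> J) + f (I \<union> J) - f I - f J" by blast
  let ?g = "restrict f (Pow {1..n})"
  have "s = T n ?g"
  proof
    fix p
    show "s p = T n ?g p"
    proof (cases "p \<in> close_pairs n")
      case True
      then obtain I J where p: "p = {I, J}" "I \<subseteq> {1..n}" "J \<subseteq> {1..n}" "close I J"
        unfolding close_pairs_def by blast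
      have "I \<in> Pow {1..n}" "J \<in> Pow {1..n}" "I \<inter> J \<in> Pow {1..n}" "I \<union> J \<in> Pow {1..n}"
        using p by blast+
      then have "T n ?g p = f (I \<inter> J) + f (I \<union> J) - f I - f J"
        unfolding p(1) T_apply[OF p(2-4)] by (simp only: restrict_apply if_True)
      then show ?thesis
        using f[OF p(2-4)] p(1) by (simp only:)
    next
      case False
      then show ?thesis
        using PiE_arb[OF s False] by (simp add: T_def)
    qed
  qed
  moreover have "?g \<in> Pow {1..n} \<rightarrow>\<^sub>E UNIV" by simp
  ultimately show "s \<in> im_T n" unfolding im_T_def by (rule image_eqI)
qed

text \<open>
  A permutation \<open>(\<sigma>\<^sub>1, \<dots>, \<sigma>\<^sub>n)\<close> is a function with \<^term>\<open>\<sigma> permutes {1..n}\<close>, and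
  \<open>\<sigma>\<^sub>i\<close> is \<^term>\<open>\<sigma> i\<close>.
\<close>

definition path_I :: "(nat \<Rightarrow> nat) \<Rightarrow> nat \<Rightarrow> nat set" where
  "path_I \<sigma> r = \<sigma> ` {1..r}"

definition path_J :: "(nat \<Rightarrow> nat) \<Rightarrow> nat \<Rightarrow> nat set" where
  "path_J \<sigma> r = \<sigma> ` {2..r + 1}"

definition path_sum :: "nat \<Rightarrow> (nat set set \<Rightarrow> real) \<Rightarrow> (nat \<Rightarrow> nat) \<Rightarrow> real" where
  "path_sum n s \<sigma> = (\<Sum>r = 1..n - 1. s {path_I \<sigma> r, path_J \<sigma> r})"

end

theory Submission
  imports Defs
begin

text \<open>
  Along a path the sum of \<open>T f\<close> telescopes to \<open>f [n] + f {} - f {\<sigma>\<^sub>1} - f ([n] - {\<sigma>\<^sub>1})\<close>, so (1) gives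
  (2). Exchanging two adjacent entries \<open>\<sigma>\<^sub>p\<close>, \<open>\<sigma>\<^sub>p\<^sub>+\<^sub>1\<close> with \<open>p \<ge> 2\<close> keeps \<open>\<sigma>\<^sub>1\<close> and changes only the
  summands \<open>p - 1\<close> and \<open>p\<close>; comparing the two path sums is exactly the relation (3). Finally, (3) makes
  the recursion \<open>f (I \<union> J) = s\<^sub>I\<^sub>,\<^sub>J + f I + f J - f (I \<inter> J)\<close> on the cardinality of \<open>I \<union> J\<close> independent
  of the choice of the close pair with a given union, which yields \<open>f\<close> with \<open>T f = s\<close>.
\<close>

section \<open>Close pairs as one-element deletions from their union\<close>

text \<open>Together with \<open>close_obtain\<close> this parametrises close pairs by their union
  and two distinct elements of it, the form that suits an induction on the union.\<close>

lemma close_remove: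
  assumes "finite A" "i \<in> A" "j \<in> A" "i \<noteq> j"
  shows "close (A - {j}) (A - {i})"
proof -
  have "card {i, j} \<le> card A" using assms by (intro card_mono) auto
  then have "2 \<le> card A" using assms by simp
  moreover have "(A - {j}) \<inter> (A - {i}) = A - {i, j}" "(A - {j}) \<union> (A - {i}) = A"
    using assms by auto
  moreover have "card (A - {i, j}) = card A - 2"
    using assms by (subst card_Diff_subset) auto
  ultimately show ?thesis using assms by (simp add: close_def)
qed

text \<open>The cardinalities force both differences \<open>I - J\<close> and \<open>J - I\<close>
  to be singletons; their elements are \<open>i\<close> and \<open>j\<close>.\<close>

lemma close_obtain:
  assumes "finite I" "finite J" "close I J"
  obtains i j where "i \<in> I \<union> J" "j \<in> I \<union> J" "i \<noteq> j"
    "I = (I \<union> J) - {j}" "J = (I \<union> J) - {i}" "I \<inter> J = (I \<union> J) - {i, j}"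
proof -
  have "card (I - J) = 1" "card (J - I) = 1"
    using assms unfolding close_def
    by (simp_all add: card_Diff_subset_Int Int_commute) linarith+
  then obtain i j where ij: "I - J = {i}" "J - I = {j}"
    by (auto simp: card_1_singleton_iff)
  show thesis
    by (rule that[of i j]) (use ij in blast)+
qed

section \<open>Path sums of a vector that has a potential\<close>

text \<open>The union of the \<open>r\<close>-th pair is the next \<open>path_I\<close> and its
  intersection is the previous \<open>path_J\<close>. Hence the summand is h(r+1) - h(r) with h(r) =
  \<open>f (path_I \<sigma> r) - f (path_J \<sigma> (r - 1))\<close>.\<close>

lemma path_sum_telescope:
  fixes f :: "nat set \<Rightarrow> real"
  assumes \<sigma>: "\<sigma> permutes {1..n}" and "n \<ge> 1"
    and f: "\<And>I J. I \<subseteq> {1..n} \<Longrightarrow> J \<subseteq> {1..n} \<Longrightarrow> close I J \<Longrightarrow>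
              s {I, J} = f (I \<inter> J) + f (I \<union> J) - f I - f J"
  shows "path_sum n s \<sigma> = f {1..n} - f {\<sigma> 1} + f {} - f ({1..n} - {\<sigma> 1})"
proof -
  have inj: "inj \<sigma>" using \<sigma> by (rule permutes_inj)
  have "path_sum n s \<sigma> =
      (\<Sum>r = 1..n - 1. (f (path_I \<sigma> (Suc r)) - f (path_J \<sigma> r)) -
                          (f (path_I \<sigma> r) - f (path_J \<sigma> (r - 1))))"
    unfolding path_sum_def
  proof (rule sum.cong[OF refl])
    fix r assume r: "r \<in> {1..n - 1}"
    let ?A = "\<sigma> ` {1..Suc r}"
    have "{1..Suc r} \<subseteq> {1..n}" using r by auto
    then have sub: "?A \<subseteq> {1..n}" using permutes_image[OF \<sigma>] by (metis image_mono)
    have I: "path_I \<sigma> r = ?A - {\<sigma> (Suc r)}" and J: "path_J \<sigma> r = ?A - {\<sigma> 1}"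
      unfolding path_I_def path_J_def using r
      by (auto simp: image_set_diff[OF inj, symmetric] inj_eq[OF inj] le_Suc_eq)
    have un: "path_I \<sigma> r \<union> path_J \<sigma> r = path_I \<sigma> (Suc r)"
      unfolding path_I_def path_J_def image_Un[symmetric] using r
      by (intro arg_cong[where f = "image \<sigma>"]) auto
    \<comment> \<open>For \<open>r = 1\<close> both sides are empty, since
      \<open>path_J \<sigma> 0\<close> is the image of \<open>{2..1}\<close>.\<close>
    have int: "path_I \<sigma> r \<inter> path_J \<sigma> r = path_J \<sigma> (r - 1)"
      unfolding path_I_def path_J_def image_Int[OF inj, symmetric] using r
      by (intro arg_cong[where f = "image \<sigma>"]) auto
    have cl: "close (path_I \<sigma> r) (path_J \<sigma> r)"
      unfolding I J using r by (intro close_remove) (auto simp: inj_eq[OF inj])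
    have "path_I \<sigma> r \<subseteq> {1..n}" "path_J \<sigma> r \<subseteq> {1..n}"
      unfolding I J using sub by (rule subset_trans[OF Diff_subset])+
    then have "s {path_I \<sigma> r, path_J \<sigma> r} = f (path_I \<sigma> r \<inter> path_J \<sigma> r) +
        f (path_I \<sigma> r \<union> path_J \<sigma> r) - f (path_I \<sigma> r) - f (path_J \<sigma> r)"
      using cl by (rule f)
    then show "s {path_I \<sigma> r, path_J \<sigma> r} =
        (f (path_I \<sigma> (Suc r)) - f (path_J \<sigma> r)) - (f (path_I \<sigma> r) - f (path_J \<sigma> (r - 1)))"
      unfolding un int by simp
  qed
  also have "\<dots> = (f (path_I \<sigma> n) - f (path_J \<sigma> (n - 1))) - (f (path_I \<sigma> 1) - f (path_J \<sigma> 0))"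
    using sum_Suc_diff[of 1 "n - 1" "\<lambda>r. f (path_I \<sigma> r) - f (path_J \<sigma> (r - 1))"] \<open>n \<ge> 1\<close> by simp
  also have "path_I \<sigma> n = {1..n}" using permutes_image[OF \<sigma>] by (simp add: path_I_def)
  also have "path_J \<sigma> (n - 1) = {1..n} - {\<sigma> 1}"
  proof -
    have "path_J \<sigma> (n - 1) = \<sigma> ` ({1..n} - {1})"
      unfolding path_J_def using \<open>n \<ge> 1\<close> by (intro arg_cong[where f = "image \<sigma>"]) auto
    then show ?thesis
      using permutes_image[OF \<sigma>] by (simp add: image_set_diff[OF inj])
  qed
  also have "path_I \<sigma> 1 = {\<sigma> 1}" by (simp add: path_I_def)
  also have "path_J \<sigma> 0 = {}" by (simp add: path_J_def)
  finally show ?thesis by simp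
qed

section \<open>Adjacent transpositions and the local relation\<close>

text \<open>The transposition can move \<open>{1..r}\<close> only if \<open>r = p\<close>, and
  \<open>{2..r + 1}\<close> only if \<open>r + 1 = p\<close>. So all summands except those at
  \<open>p - 1\<close> and \<open>p\<close> cancel, and in these two only \<open>path_J\<close> at
  \<open>p - 1\<close> and \<open>path_I\<close> at \<open>p\<close> change.\<close>

lemma path_sum_adjacent_transpose:
  assumes p: "2 \<le> p" "p < n"
    and eq: "path_sum n s (\<sigma> \<circ> transpose p (Suc p)) = path_sum n s \<sigma>"
  shows "s {\<sigma> ` {1..p - 1}, \<sigma> ` {2..p}} + s {\<sigma> ` {1..p}, \<sigma> ` {2..Suc p}} =
         s {\<sigma> ` {1..p - 1}, \<sigma> ` insert (Suc p) {2..p - 1}} +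
         s {\<sigma> ` insert (Suc p) {1..p - 1}, \<sigma> ` {2..Suc p}}"
proof -
  let ?t = "transpose p (Suc p)" and ?s = "\<lambda>\<sigma> r. s {path_I \<sigma> r, path_J \<sigma> r}"
  have split: "path_sum n s \<rho> =
      (\<Sum>r \<in> {1..n - 1} - {p - 1, p}. ?s \<rho> r) + (?s \<rho> (p - 1) + ?s \<rho> p)" for \<rho>
    unfolding path_sum_def using p
    by (subst sum.subset_diff[of "{p - 1, p}"]) auto
  \<comment> \<open>Such an interval contains both \<open>p\<close> and \<open>Suc p\<close> or
    neither of them.\<close>
  have same: "?t ` {a..b} = {a..b}" if "a \<le> p" "b \<noteq> p" for a b
    using that by (intro transpose_image_eq) auto
  have swap: "?t ` {a..p} = insert (Suc p) {a..p - 1}" if "a \<le> p" for a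
  proof -
    have "{a..p} = insert p {a..p - 1}" using that p by auto
    moreover have "?t ` {a..p - 1} = {a..p - 1}" using p by (intro transpose_image_eq) auto
    ultimately show ?thesis by simp
  qed
  have "(\<Sum>r \<in> {1..n - 1} - {p - 1, p}. ?s (\<sigma> \<circ> ?t) r) = (\<Sum>r \<in> {1..n - 1} - {p - 1, p}. ?s \<sigma> r)"
  proof (rule sum.cong[OF refl])
    fix r assume "r \<in> {1..n - 1} - {p - 1, p}"
    then have "r \<noteq> p" "r + 1 \<noteq> p" by auto
    with p have "?t ` {1..r} = {1..r}" "?t ` {2..r + 1} = {2..r + 1}"
      by (intro same; linarith)+
    then show "?s (\<sigma> \<circ> ?t) r = ?s \<sigma> r"
      by (simp only: path_I_def path_J_def image_comp[symmetric])
  qed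
  with eq have "?s (\<sigma> \<circ> ?t) (p - 1) + ?s (\<sigma> \<circ> ?t) p = ?s \<sigma> (p - 1) + ?s \<sigma> p"
    unfolding split by simp
  then show ?thesis
    unfolding path_I_def path_J_def image_comp[symmetric]
    using p same[of 1 "p - 1"] same[of 2 "Suc p"] swap[of 1] swap[of 2] by simp
qed

text \<open>The entries are listed in the order \<open>i\<close>, \<open>I\<close>,
  \<open>j\<close>, \<open>k\<close>, then the remaining elements \<open>R\<close>, by gluing
  bijections on consecutive blocks of positions. Counting gives \<open>n = p + 1 + card R\<close>,
  whence \<open>p < n\<close>.\<close>

lemma permutes_with_prefix:
  assumes "i \<in> {1..n}" "j \<in> {1..n}" "k \<in> {1..n}" "i \<noteq> j" "i \<noteq> k" "j \<noteq> k"
    and I: "I \<subseteq> {1..n} - {i, j, k}" and p: "p = card I + 2"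
  obtains \<sigma> where "\<sigma> permutes {1..n}" "p < n" "\<sigma> 1 = i" "\<sigma> ` {2..p - 1} = I" "\<sigma> p = j" "\<sigma> (Suc p) = k"
proof -
  define R where "R = {1..n} - {i, j, k} - I"
  have fin: "finite I" "finite R" using I by (auto simp: R_def intro: finite_subset)
  have "card ({i, j, k} \<union> I \<union> R) = card {i, j, k} + card I + card R"
    using I fin by (subst card_Un_disjoint; (subst card_Un_disjoint)?) (auto simp: R_def)
  moreover have un: "{i, j, k} \<union> I \<union> R = {1..n}" using assms by (auto simp: R_def)
  ultimately have n: "n = card I + 3 + card R" using assms by simp
  obtain g where g: "bij_betw g {2..p - 1} I"
    using fin finite_same_card_bij[of "{2..p - 1}" I] p by auto
  obtain h where h: "bij_betw h {p + 2..n} R"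
    using fin finite_same_card_bij[of "{p + 2..n}" R] p n by auto
  \<comment> \<open>The last branch makes \<open>\<sigma>\<close> the identity outside
    \<open>{1..n}\<close>, as \<open>permutes\<close> demands.\<close>
  define \<sigma> where "\<sigma> x = (if x = 1 then i else if x \<in> {2..p - 1} then g x else if x = p then j
    else if x = Suc p then k else if x \<in> {p + 2..n} then h x else x)" for x
  have dom: "{1..n} = {1} \<union> {2..p - 1} \<union> {p} \<union> {Suc p} \<union> {p + 2..n}" using p n by auto
  have bij: "bij_betw \<sigma> {1..n} ({i} \<union> I \<union> {j} \<union> {k} \<union> R)"
    unfolding dom
  proof (intro bij_betw_combine)
    show "bij_betw \<sigma> {2..p - 1} I" using g by (subst bij_betw_cong[of _ _ g]) (auto simp: \<sigma>_def)
    show "bij_betw \<sigma> {p + 2..n} R" using h p by (subst bij_betw_cong[of _ _ h]) (auto simp: \<sigma>_def)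
  qed (use I p assms in \<open>auto simp: \<sigma>_def R_def bij_betw_def\<close>)
  show thesis
  proof (rule that)
    have "{i} \<union> I \<union> {j} \<union> {k} \<union> R = {1..n}" using un by auto
    with bij show "\<sigma> permutes {1..n}"
      by (intro bij_imp_permutes) (use p n in \<open>auto simp: \<sigma>_def\<close>)
    have "\<sigma> ` {2..p - 1} = g ` {2..p - 1}" by (intro image_cong) (auto simp: \<sigma>_def)
    then show "\<sigma> ` {2..p - 1} = I" using g by (simp add: bij_betw_def)
  qed (use p n in \<open>auto simp: \<sigma>_def\<close>)
qed

text \<open>In a permutation that starts with \<open>i\<close>, the elements of \<open>I\<close>,
  \<open>j\<close>, \<open>k\<close>, exchanging \<open>j\<close> and \<open>k\<close> preserves the
  first entry and therefore the path sum.\<close>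

lemma path_sum_imp_local_relation:
  assumes m: "\<And>\<sigma>. \<sigma> permutes {1..n} \<Longrightarrow> path_sum n s \<sigma> = m (\<sigma> 1)"
    and ijk: "i \<in> {1..n}" "j \<in> {1..n}" "k \<in> {1..n}" "i \<noteq> j" "i \<noteq> k" "j \<noteq> k"
    and I: "I \<subseteq> {1..n} - {i, j, k}"
  shows "s {I \<union> {i}, I \<union> {j}} + s {I \<union> {i, j}, I \<union> {j, k}} =
         s {I \<union> {i}, I \<union> {k}} + s {I \<union> {i, k}, I \<union> {j, k}}"
proof -
  define p where "p = card I + 2"
  obtain \<sigma> where \<sigma>: "\<sigma> permutes {1..n}" "p < n" "\<sigma> 1 = i" "\<sigma> ` {2..p - 1} = I" "\<sigma> p = j" "\<sigma> (Suc p) = k"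
    using permutes_with_prefix[OF ijk I p_def] .
  have p: "2 \<le> p" by (simp add: p_def)
  have "(\<sigma> \<circ> transpose p (Suc p)) permutes {1..n}"
    using \<sigma>(1,2) p by (intro permutes_compose permutes_swap_id) auto
  moreover have "(\<sigma> \<circ> transpose p (Suc p)) 1 = \<sigma> 1" using p by (simp add: transpose_def)
  ultimately have "path_sum n s (\<sigma> \<circ> transpose p (Suc p)) = path_sum n s \<sigma>"
    using m \<sigma>(1) by metis
  note rel = path_sum_adjacent_transpose[OF p \<sigma>(2) this]
  have sets: "{1..p - 1} = insert 1 {2..p - 1}" "{2..p} = insert p {2..p - 1}"
    "{1..p} = insert 1 (insert p {2..p - 1})" "{2..Suc p} = insert p (insert (Suc p) {2..p - 1})"
    using p by auto
  have "\<sigma> ` {1..p - 1} = I \<union> {i}" "\<sigma> ` {2..p} = I \<union> {j}" "\<sigma> ` {1..p} = I \<union> {i, j}"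
    "\<sigma> ` {2..Suc p} = I \<union> {j, k}" "\<sigma> ` insert (Suc p) {2..p - 1} = I \<union> {k}"
    "\<sigma> ` insert (Suc p) {1..p - 1} = I \<union> {i, k}"
    unfolding sets image_insert \<sigma>(3-6) by auto
  with rel show ?thesis by (simp only:)
qed

section \<open>Integrating the local relation to a potential\<close>

text \<open>A potential valid up to cardinality \<open>N\<close> is extended to sets of cardinality
  \<open>Suc N\<close>: every pair of distinct elements of such a set prescribes a value there, and
  the local relation makes these values agree.\<close>

lemma local_relation_imp_potential:
  fixes s :: "nat set set \<Rightarrow> real"
  assumes rel: "\<And>i j k I. i \<in> {1..n} \<Longrightarrow> j \<in> {1..n} \<Longrightarrow> k \<in> {1..n} \<Longrightarrow>
      i \<noteq> j \<Longrightarrow> i \<noteq> k \<Longrightarrow> j \<noteq> k \<Longrightarrow> I \<subseteq> {1..n} - {i, j, k} \<Longrightarrow>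
      s {I \<union> {i}, I \<union> {j}} + s {I \<union> {i, j}, I \<union> {j, k}} =
      s {I \<union> {i}, I \<union> {k}} + s {I \<union> {i, k}, I \<union> {j, k}}"
  shows "\<exists>f. \<forall>A i j. A \<subseteq> {1..n} \<longrightarrow> card A \<le> N \<longrightarrow> i \<in> A \<longrightarrow> j \<in> A \<longrightarrow> i \<noteq> j \<longrightarrow>
      f A = s {A - {j}, A - {i}} + f (A - {j}) + f (A - {i}) - f (A - {i, j})"
proof (induction N)
  case 0
  have "i \<notin> A" if "A \<subseteq> {1..n}" "card A \<le> 0" for A and i :: nat
    using that finite_subset[OF that(1)] by simp
  then show ?case by blast
next
  case (Suc N)
  then obtain f where f: "\<And>A i j. A \<subseteq> {1..n} \<Longrightarrow> card A \<le> N \<Longrightarrow> i \<in> A \<Longrightarrow> j \<in> A \<Longrightarrow> i \<noteq> j \<Longrightarrow>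
      f A = s {A - {j}, A - {i}} + f (A - {j}) + f (A - {i}) - f (A - {i, j})"
    by blast
  define F where "F A i j = s {A - {j}, A - {i}} + f (A - {j}) + f (A - {i}) - f (A - {i, j})" for A i j
  have F_sym: "F A i j = F A j i" for A i j
    by (simp add: F_def insert_commute)
  \<comment> \<open>Expanding \<open>f (A - {j})\<close> and \<open>f (A - {k})\<close> by the
    induction hypothesis leaves the same \<open>f\<close> terms on both sides; the remaining
    \<open>s\<close> terms are the local relation for \<open>I = A - {i, j, k}\<close>.\<close>
  have F_step: "F A i j = F A i k"
    if A: "A \<subseteq> {1..n}" "card A = Suc N" and ijk: "i \<in> A" "j \<in> A" "k \<in> A" "i \<noteq> j" "i \<noteq> k"
    for A i j k
  proof (cases "j = k")
    case False
    define I where "I = A - {i, j, k}"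
    have fin: "finite A" using A(1) by (rule finite_subset) simp
    have AI: "A - {j} = I \<union> {i, k}" "A - {k} = I \<union> {i, j}" "A - {i} = I \<union> {j, k}"
      "A - {i, j} = I \<union> {k}" "A - {i, k} = I \<union> {j}"
      using ijk False by (auto simp: I_def)
    have fil: "f (I \<union> {i, l}) = s {I \<union> {i}, I \<union> {l}} + f (I \<union> {i}) + f (I \<union> {l}) - f I"
      if "l \<in> {j, k}" for l
    proof -
      let ?X = "I \<union> {i, l}"
      have "?X \<subseteq> {1..n}" using A(1) ijk that by (auto simp: I_def)
      moreover have "card ?X \<le> N"
      proof -
        have "?X \<subset> A" using ijk False that by (auto simp: I_def)
        from psubset_card_mono[OF fin this] show ?thesis using A(2) by simp
      qed
      ultimately have "f ?X = s {?X - {l}, ?X - {i}} + f (?X - {l}) + f (?X - {i}) - f (?X - {i, l})"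
        using ijk that by (intro f) auto
      moreover have "?X - {l} = I \<union> {i}" "?X - {i} = I \<union> {l}" "?X - {i, l} = I"
        using ijk that by (auto simp: I_def)
      ultimately show ?thesis by (simp only:)
    qed
    have fik: "f (I \<union> {i, k}) = s {I \<union> {i}, I \<union> {k}} + f (I \<union> {i}) + f (I \<union> {k}) - f I"
      and fij: "f (I \<union> {i, j}) = s {I \<union> {i}, I \<union> {j}} + f (I \<union> {i}) + f (I \<union> {j}) - f I"
      by (simp_all only: fil insert_iff simp_thms)
    have "s {I \<union> {i}, I \<union> {j}} + s {I \<union> {i, j}, I \<union> {j, k}} =
        s {I \<union> {i}, I \<union> {k}} + s {I \<union> {i, k}, I \<union> {j, k}}"
      using A ijk False by (intro rel) (auto simp: I_def)
    then show ?thesis unfolding F_def AI fik fij by simp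
  qed simp
  \<comment> \<open>One index is replaced at a time, with \<open>F_sym\<close> to reach the first
    one. The route through the pair \<open>i\<close>, \<open>l\<close> requires
    \<open>i \<noteq> l\<close>.\<close>
  have F_const: "F A i j = F A k l"
    if "A \<subseteq> {1..n}" "card A = Suc N" "i \<in> A" "j \<in> A" "k \<in> A" "l \<in> A" "i \<noteq> j" "k \<noteq> l" for A i j k l
  proof (cases "i = l")
    case True
    have "F A i j = F A i k" by (rule F_step) (use that True in auto)
    then show ?thesis unfolding True by (simp only: F_sym[of A k l])
  next
    case False
    have "F A i j = F A i l" by (rule F_step) (use that False in auto)
    also have "\<dots> = F A l i" by (rule F_sym)
    also have "\<dots> = F A l k" by (rule F_step) (use that False in auto)
    also have "\<dots> = F A k l" by (rule F_sym)
    finally show ?thesis .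
  qed
  \<comment> \<open>\<open>SOME\<close> selects the common value of \<open>F A\<close>. For
    \<open>N = 0\<close> the sets concerned are singletons, the condition is vacuous and the value
    is arbitrary.\<close>
  define g where "g A = (if card A = Suc N then SOME v. \<forall>i\<in>A. \<forall>j\<in>A. i \<noteq> j \<longrightarrow> v = F A i j else f A)" for A
  have g_F: "g A = F A i j"
    if "A \<subseteq> {1..n}" "card A = Suc N" "i \<in> A" "j \<in> A" "i \<noteq> j" for A i j
  proof -
    have "\<exists>v. \<forall>i\<in>A. \<forall>j\<in>A. i \<noteq> j \<longrightarrow> v = F A i j"
      by (intro exI[of _ "F A i j"] ballI impI F_const) (use that in auto)
    from someI_ex[OF this] show ?thesis using that by (simp add: g_def)
  qed
  have g_f: "g A = f A" if "card A \<noteq> Suc N" for A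
    using that by (simp add: g_def)
  have "g A = s {A - {j}, A - {i}} + g (A - {j}) + g (A - {i}) - g (A - {i, j})"
    if A: "A \<subseteq> {1..n}" "card A \<le> Suc N" and ij: "i \<in> A" "j \<in> A" "i \<noteq> j" for A i j
  proof -
    have fin: "finite A" using A(1) by (rule finite_subset) simp
    \<comment> \<open>All sets on the right-hand side are proper subsets of \<open>A\<close>, hence
      of cardinality at most \<open>N\<close>, where \<open>g\<close> agrees with
      \<open>f\<close>.\<close>
    have g_psubset: "g B = f B" if "B \<subset> A" for B
      using psubset_card_mono[OF fin that] A(2) by (intro g_f) simp
    have smaller: "g (A - {j}) = f (A - {j})" "g (A - {i}) = f (A - {i})"
      "g (A - {i, j}) = f (A - {i, j})"
      by (rule g_psubset; use ij in blast)+
    show ?thesis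
    proof (cases "card A = Suc N")
      case True
      then show ?thesis unfolding smaller g_F[OF A(1) True ij] F_def by simp
    next
      case False
      with A(2) have "card A \<le> N" by simp
      then show ?thesis unfolding smaller g_f[OF False] by (rule f[OF A(1) _ ij])
    qed
  qed
  then show ?case by (intro exI[of _ g] allI impI)
qed

section \<open>The cycle of implications between the three conditions\<close>

theorem theorem3p6:
  fixes n :: nat and s :: "nat set set \<Rightarrow> real"
  assumes "n \<ge> 1" and "s \<in> close_pairs n \<rightarrow>\<^sub>E UNIV"
  shows "(s \<in> im_T n \<longleftrightarrow>
           (\<exists>m :: nat \<Rightarrow> real. \<forall>\<sigma>. \<sigma> permutes {1..n} \<longrightarrow> path_sum n s \<sigma> = m (\<sigma> 1))) \<and>
         ((\<exists>m :: nat \<Rightarrow> real. \<forall>\<sigma>. \<sigma> permutes {1..n} \<longrightarrow> path_sum n s \<sigma> = m (\<sigma> 1)) \<longleftrightarrow>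
           (\<forall>i\<in>{1..n}. \<forall>j\<in>{1..n}. \<forall>k\<in>{1..n}. i \<noteq> j \<longrightarrow> i \<noteq> k \<longrightarrow> j \<noteq> k \<longrightarrow>
             (\<forall>I. I \<subseteq> {1..n} - {i, j, k} \<longrightarrow>
               s {I \<union> {i}, I \<union> {j}} + s {I \<union> {i, j}, I \<union> {j, k}} =
               s {I \<union> {i}, I \<union> {k}} + s {I \<union> {i, k}, I \<union> {j, k}})))"
    (is "(?P1 \<longleftrightarrow> ?P2) \<and> (_ \<longleftrightarrow> ?P3)")
proof -
  have "?P2" if ?P1
  proof -
    from that obtain f where "\<And>I J. I \<subseteq> {1..n} \<Longrightarrow> J \<subseteq> {1..n} \<Longrightarrow> close I J \<Longrightarrow>
        s {I, J} = f (I \<inter> J) + f (I \<union> J) - f I - f J"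
      unfolding in_im_T_iff[OF assms(2)] by blast
    from path_sum_telescope[OF _ assms(1) this] show ?P2
      \<comment> \<open>The witness is the telescoped value, which depends on the permutation only
        through its first entry.\<close>
      by (intro exI[of _ "\<lambda>x. f {1..n} - f {x} + f {} - f ({1..n} - {x})"]) blast
  qed
  moreover have ?P3 if ?P2
    using that path_sum_imp_local_relation by blast
  moreover have ?P1 if ?P3
  proof -
    from that have rel: "s {I \<union> {i}, I \<union> {j}} + s {I \<union> {i, j}, I \<union> {j, k}} =
        s {I \<union> {i}, I \<union> {k}} + s {I \<union> {i, k}, I \<union> {j, k}}"
      if "i \<in> {1..n}" "j \<in> {1..n}" "k \<in> {1..n}" "i \<noteq> j" "i \<noteq> k" "j \<noteq> k"
        "I \<subseteq> {1..n} - {i, j, k}" for i j k I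
      using that by blast
    \<comment> \<open>The bound \<open>n\<close> on the cardinality covers every subset of
      \<open>{1..n}\<close>.\<close>
    obtain f where f: "\<And>A i j. A \<subseteq> {1..n} \<Longrightarrow> card A \<le> n \<Longrightarrow> i \<in> A \<Longrightarrow> j \<in> A \<Longrightarrow> i \<noteq> j \<Longrightarrow>
        f A = s {A - {j}, A - {i}} + f (A - {j}) + f (A - {i}) - f (A - {i, j})"
      using local_relation_imp_potential[OF rel, of n] by blast
    have "s {I, J} = f (I \<inter> J) + f (I \<union> J) - f I - f J"
      if IJ: "I \<subseteq> {1..n}" "J \<subseteq> {1..n}" "close I J" for I J
    proof -
      have "finite I" "finite J" using IJ by (auto intro: finite_subset)
      from this IJ(3) obtain i j where ij: "i \<in> I \<union> J" "j \<in> I \<union> J" "i \<noteq> j"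
        "I = (I \<union> J) - {j}" "J = (I \<union> J) - {i}" "I \<inter> J = (I \<union> J) - {i, j}"
        by (rule close_obtain)
      have "I \<union> J \<subseteq> {1..n}" using IJ by blast
      moreover from this have "card (I \<union> J) \<le> n" using card_mono[of "{1..n}"] by fastforce
      \<comment> \<open>The recursion for \<open>f\<close> at the set \<open>I \<union> J\<close>,
        read through the deletions from \<open>close_obtain\<close>, is the equation for the pair
        \<open>I\<close>, \<open>J\<close>.\<close>
      ultimately have "f (I \<union> J) = s {I, J} + f I + f J - f (I \<inter> J)"
        using f[of "I \<union> J" i j] ij(1-3) unfolding ij(4-6)[symmetric] by blast
      then show ?thesis by simp
    qed
    then show ?P1 unfolding in_im_T_iff[OF assms(2)] by blast
  qed
  ultimately show ?thesis by blast
qed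

end
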